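(* Let $\mathcal{F}$ be a family of functions meromorphic in a domain $D\subseteq\mathbb{C}$. Let $a_1,a_2,a_3$ be three distinct holomorphic functions on $D$. If each pair $f,g\in\mathcal{F}$ shares $a_1$, $a_2$ and $a_3$ in $D$, i.e. for each $j\in\{1,2,3\}$ and all $z\in D$ one has $f(z)=a_j(z)$ if and only if $g(z)=a_j(z)$, then $\mathcal{F}$ is quasi-normal in $D$.
   Context: Functions $a_i$ and $a_j$ are distinct if they are not identically equal on $D$. A family $\mathcal{F}$ of meromorphic functions on a domain $D$ is called quasi-normal on $D$ if every sequence $\{f_n\}$ of functions in $\mathcal{F}$ has a subsequence which converges uniformly on compact subsets of $D\setminus E$ with respect to the spherical metric (the limit being meromorphic or identically $\infty$), where $E\subset D$ is a set (which may depend on the sequence) with no accumulation points in $D$. *)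

theory Defs
  imports "HOL-Complex_Analysis.Complex_Analysis"
begin

(* The Riemann sphere is rendered as complex option, with None as the point at infinity. *)

(* Stereographic projection from the north pole (0, 1) of the unit sphere in C x R. *)
fun stereographic :: "complex option \<Rightarrow> complex \<times> real" where
  "stereographic (Some z) =
     ((2 / ((cmod z)\<^sup>2 + 1)) *\<^sub>R z, ((cmod z)\<^sup>2 - 1) / ((cmod z)\<^sup>2 + 1))"
| "stereographic None = (0, 1)"

lemma norm_stereographic: "norm (stereographic p) = 1"
proof (cases p)
  case None
  then show ?thesis by (simp add: norm_prod_def)
next
  case (Some z)
  define s where "s = (cmod z)\<^sup>2 + 1"
  have "s > 0" by (simp add: s_def add_nonneg_pos)
  have "(norm (stereographic p))\<^sup>2 = (2 / s * cmod z)\<^sup>2 + (((cmod z)\<^sup>2 - 1) / s)\<^sup>2"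
    using \<open>s > 0\<close> by (simp add: Some norm_prod_def s_def[symmetric] power_divide)
  also have "\<dots> = (4 * (s - 1) + (s - 2)\<^sup>2) / s\<^sup>2"
    by (simp add: s_def power_mult_distrib power_divide add_divide_distrib)
  also have "\<dots> = 1"
    using \<open>s > 0\<close> by (simp add: power2_eq_square field_simps)
  finally show ?thesis
    by (metis norm_ge_zero power2_eq_1_iff neg_0_le_iff_le not_one_le_zero)
qed

(* Great-circle distance: the angle between the corresponding unit vectors. *)
definition spherical_dist :: "complex option \<Rightarrow> complex option \<Rightarrow> real" where
  "spherical_dist p q = arccos (stereographic p \<bullet> stereographic q)"

(* In the library a meromorphic function is complex-valued, and one that is nicely_meromorphic_on
   takes the junk value 0 at its poles.  This is the associated map into the Riemann sphere. *)
definition sphere_val :: "(complex \<Rightarrow> complex) \<Rightarrow> complex \<Rightarrow> complex option" where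
  "sphere_val f z = (if is_pole f z then None else Some (f z))"

definition shares_on ::
  "(complex \<Rightarrow> complex) \<Rightarrow> (complex \<Rightarrow> complex) \<Rightarrow> (complex \<Rightarrow> complex) \<Rightarrow> complex set \<Rightarrow> bool" where
  "shares_on f g a D \<longleftrightarrow>
     (\<forall>z\<in>D. sphere_val f z = Some (a z) \<longleftrightarrow> sphere_val g z = Some (a z))"

definition spherical_limit_on ::
  "(nat \<Rightarrow> complex \<Rightarrow> complex) \<Rightarrow> (complex \<Rightarrow> complex option) \<Rightarrow> complex set \<Rightarrow> bool" where
  "spherical_limit_on f G U \<longleftrightarrow>
     (\<forall>K. compact K \<and> K \<subseteq> U \<longrightarrow>
        (\<forall>e>0. \<forall>\<^sub>F n in sequentially. \<forall>z\<in>K. spherical_dist (sphere_val (f n) z) (G z) < e))"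

definition quasi_normal_on :: "(complex \<Rightarrow> complex) set \<Rightarrow> complex set \<Rightarrow> bool" where
  "quasi_normal_on \<F> D \<longleftrightarrow>
     (\<forall>f :: nat \<Rightarrow> complex \<Rightarrow> complex. (\<forall>n. f n \<in> \<F>) \<longrightarrow>
        (\<exists>(r :: nat \<Rightarrow> nat) E G.
           strict_mono r \<and> E \<subseteq> D \<and> (\<forall>z\<in>D. \<not> z islimpt E) \<and>
           ((\<exists>h. h nicely_meromorphic_on (D - E) \<and> G = sphere_val h) \<or> G = (\<lambda>_. None)) \<and>
           spherical_limit_on (\<lambda>n. f (r n)) G (D - E)))"

end

theory Submission
  imports Defs
begin

text \<open>
  Let \<open>f n\<close> be a sequence in the family. All its members take the values \<open>a1\<close>, \<open>a2\<close>, \<open>a3\<close> at the same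
  points as \<open>f 0\<close>. If \<open>f 0\<close> coincides with one of the three functions on all of \<open>D\<close>, then so does
  every \<open>f n\<close>, and the sequence is constant on \<open>D\<close>. Otherwise the points where \<open>f 0\<close> meets some \<open>aj\<close>, together
  with those where two of the \<open>aj\<close> meet, form a set \<open>E\<close> without accumulation points in \<open>D\<close>
  (\<open>sparse_coincidence_set\<close>). On the domain \<open>D - E\<close> every
  \<open>f n\<close> omits the three functions, whose values there are distinct at each point, so Montel's
  criterion with moving targets applies.

  To prove that criterion (\<open>normal_if_omits_three_functions\<close>), a Moebius map depending holomorphically
  on \<open>z\<close> sends \<open>a z\<close>, \<open>b z\<close>, \<open>c z\<close> to \<open>0\<close>, \<open>\<infinity>\<close>, \<open>1\<close>. The resulting cross ratios are
  holomorphic functions omitting \<open>0\<close> and \<open>1\<close>. If infinitely many of them lie in the closed unit disc at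
  one chosen point, then Schottky's theorem bounds them on compact sets, and Montel's theorem yields
  a subsequence that converges locally uniformly to a holomorphic function. Otherwise infinitely many
  of their inverses lie in the closed unit disc at that point, and the inverse is again a cross
  ratio, with the roles of \<open>a\<close> and \<open>b\<close> exchanged.

  It remains to go back from the cross ratios to the functions \<open>f n\<close>. The inverse Moebius map may hit
  \<open>\<infinity>\<close>, so its values are kept as a quotient of a numerator and a denominator without common zeros.
  In these homogeneous coordinates the stereographic projection is continuous, also where the
  denominator vanishes, and uniform convergence of the cross ratios becomes spherical convergence
  of the \<open>f n\<close>. The limit is meromorphic, or \<open>\<infinity>\<close> if its denominator vanishes identically.
\<close>

section \<open>Spherical convergence in homogeneous coordinates\<close>

text \<open>The point of the sphere with homogeneous coordinates \<open>[p : q]\<close>.\<close>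

definition ratio_point :: "complex \<Rightarrow> complex \<Rightarrow> complex option" where
  "ratio_point p q = (if q = 0 then None else Some (p / q))"

text \<open>
  The formula for the finite point \<open>p / q\<close>, cleared of fractions by the factor \<open>(cmod q)\<^sup>2\<close>; in this form
  it is also right at \<open>\<infinity>\<close>, and it is visibly continuous in \<open>p\<close> and \<open>q\<close>.
\<close>

lemma stereographic_ratio_point:
  assumes "p \<noteq> 0 \<or> q \<noteq> 0"
  shows "stereographic (ratio_point p q) =
           ((2 / ((cmod p)\<^sup>2 + (cmod q)\<^sup>2)) *\<^sub>R (p * cnj q),
            ((cmod p)\<^sup>2 - (cmod q)\<^sup>2) / ((cmod p)\<^sup>2 + (cmod q)\<^sup>2))"
proof (cases "q = 0")
  case True
  then show ?thesis using assms by (simp add: ratio_point_def)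
next
  case False
  have 1: "p / q = p * cnj q / complex_of_real ((cmod q)\<^sup>2)"
    using False by (simp add: complex_norm_square[symmetric] field_simps del: of_real_power)
  have pos: "(cmod p)\<^sup>2 + (cmod q)\<^sup>2 > 0" "(cmod q)\<^sup>2 > 0"
    using False by (auto intro: add_nonneg_pos)
  have 2: "(cmod (p / q))\<^sup>2 + 1 = ((cmod p)\<^sup>2 + (cmod q)\<^sup>2) / (cmod q)\<^sup>2"
    and 3: "(cmod (p / q))\<^sup>2 - 1 = ((cmod p)\<^sup>2 - (cmod q)\<^sup>2) / (cmod q)\<^sup>2"
    using pos by (simp_all add: norm_divide power_divide field_simps)
  have "(2 / ((cmod (p / q))\<^sup>2 + 1)) *\<^sub>R (p / q) =
        (2 / ((cmod p)\<^sup>2 + (cmod q)\<^sup>2)) *\<^sub>R (p * cnj q)"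
    unfolding 2 unfolding 1 scaleR_conv_of_real using pos
    by (simp del: of_real_power of_real_add)
  moreover have "((cmod (p / q))\<^sup>2 - 1) / ((cmod (p / q))\<^sup>2 + 1) =
        ((cmod p)\<^sup>2 - (cmod q)\<^sup>2) / ((cmod p)\<^sup>2 + (cmod q)\<^sup>2)"
    unfolding 2 3 using pos by simp
  ultimately show ?thesis
    using False by (simp add: ratio_point_def)
qed

text \<open>
  The chordal and the great-circle metric are uniformly equivalent, because \<open>(dist u v)\<^sup>2 = 2 - 2 * (u \<bullet> v)\<close>
  for unit vectors and \<open>arccos\<close> is strictly decreasing. Hence convergence may be tested
  in the Euclidean space that contains the sphere.
\<close>

lemma spherical_dist_less_if_chord_less:
  assumes "0 < e"
  obtains d where "0 < d"
    "\<And>p q. dist (stereographic p) (stereographic q) < d \<Longrightarrow> spherical_dist p q < e"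
proof -
  \<comment> \<open>The cosine is injective only up to \<open>pi\<close>, and no two points are further apart than that.\<close>
  define t where "t = min e pi"
  have t: "0 < t" "t \<le> pi" "t \<le> e" using assms pi_gt_zero by (auto simp: t_def)
  have "cos t < 1"
    using cos_monotone_0_pi[of 0 t] t by simp
  \<comment> \<open>The chord that subtends the angle \<open>t\<close>.\<close>
  define d where "d = sqrt (2 * (1 - cos t))"
  have "0 < d" using \<open>cos t < 1\<close> by (simp add: d_def)
  moreover have "spherical_dist p q < e" if "dist (stereographic p) (stereographic q) < d" for p q
  proof -
    let ?p = "stereographic p" and ?q = "stereographic q"
    have sq: "(dist ?p ?q)\<^sup>2 = 2 - 2 * (?p \<bullet> ?q)"
      using norm_stereographic[of p] norm_stereographic[of q]
      by (simp add: dist_norm power2_norm_eq_inner inner_diff_left inner_diff_right inner_commute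
          norm_eq_1)
    have "(dist ?p ?q)\<^sup>2 < d\<^sup>2"
      using that by (intro power_strict_mono) auto
    moreover have "d\<^sup>2 = 2 * (1 - cos t)" using \<open>cos t < 1\<close> by (simp add: d_def)
    ultimately have "cos t < ?p \<bullet> ?q" using sq by simp
    moreover have "?p \<bullet> ?q \<le> 1"
      using norm_cauchy_schwarz[of ?p ?q] by (simp add: norm_stereographic)
    ultimately have "arccos (?p \<bullet> ?q) < arccos (cos t)"
      by (intro arccos_less_arccos) auto
    then show ?thesis using t by (simp add: spherical_dist_def arccos_cos)
  qed
  ultimately show ?thesis using that by blast
qed

lemma spherical_limit_onI:
  assumes "\<And>K. compact K \<Longrightarrow> K \<subseteq> U \<Longrightarrow>
             uniform_limit K (\<lambda>n z. stereographic (sphere_val (f n) z)) (\<lambda>z. stereographic (G z)) sequentially"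
  shows "spherical_limit_on f G U"
  unfolding spherical_limit_on_def
proof (intro allI impI)
  fix K and e :: real
  assume K: "compact K \<and> K \<subseteq> U" and "e > 0"
  obtain d where "d > 0" and d: "\<And>p q. dist (stereographic p) (stereographic q) < d \<Longrightarrow> spherical_dist p q < e"
    using spherical_dist_less_if_chord_less[OF \<open>e > 0\<close>] by blast
  have "\<forall>\<^sub>F n in sequentially. \<forall>z\<in>K. dist (stereographic (sphere_val (f n) z)) (stereographic (G z)) < d"
    using assms[of K] K \<open>d > 0\<close> by (auto simp: uniform_limit_iff)
  then show "\<forall>\<^sub>F n in sequentially. \<forall>z\<in>K. spherical_dist (sphere_val (f n) z) (G z) < e"
    by eventually_elim (use d in blast)
qed

section \<open>The cross ratio\<close>

text \<open>
  The Moebius map that sends \<open>a\<close>, \<open>b\<close>, \<open>c\<close> to \<open>0\<close>, \<open>\<infinity>\<close>, \<open>1\<close>. At \<open>b\<close> itself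
  the division by zero yields the default \<open>0\<close> instead of \<open>\<infinity>\<close>.
\<close>

fun cross_ratio :: "complex \<Rightarrow> complex \<Rightarrow> complex \<Rightarrow> complex option \<Rightarrow> complex" where
  "cross_ratio a b c (Some u) = ((u - a) * (c - b)) / ((u - b) * (c - a))"
| "cross_ratio a b c None = (c - b) / (c - a)"

text \<open>
  Solving \<open>w = cross_ratio a b c u\<close> for \<open>u\<close> gives the quotient of the following numerator and denominator.
\<close>

definition cr_num :: "complex \<Rightarrow> complex \<Rightarrow> complex \<Rightarrow> complex \<Rightarrow> complex" where
  "cr_num a b c w = w * (c - a) * b - (c - b) * a"

definition cr_den :: "complex \<Rightarrow> complex \<Rightarrow> complex \<Rightarrow> complex \<Rightarrow> complex" where
  "cr_den a b c w = w * (c - a) - (c - b)"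

lemma cr_num_or_den_nonzero:
  assumes "a \<noteq> b" "b \<noteq> c"
  shows "cr_num a b c w \<noteq> 0 \<or> cr_den a b c w \<noteq> 0"
proof -
  \<comment> \<open>In this combination \<open>w\<close> cancels.\<close>
  have "cr_num a b c w - b * cr_den a b c w = (c - b) * (b - a)"
    by (simp add: cr_num_def cr_den_def algebra_simps)
  then show ?thesis using assms by auto
qed

lemma ratio_point_cross_ratio:
  assumes "a \<noteq> b" "b \<noteq> c" "a \<noteq> c" "u \<noteq> Some b"
  shows "ratio_point (cr_num a b c (cross_ratio a b c u)) (cr_den a b c (cross_ratio a b c u)) = u"
proof (cases u)
  case None
  then show ?thesis using assms by (simp add: ratio_point_def cr_den_def)
next
  case (Some v)
  have "v \<noteq> b" using Some assms by simp
  have eq: "cross_ratio a b c u * (c - a) = (v - a) * (c - b) / (v - b)"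
    using assms by (simp add: Some)
  have "cr_den a b c (cross_ratio a b c u) = (c - b) * (b - a) / (v - b)"
    unfolding cr_den_def eq using \<open>v \<noteq> b\<close> by (simp add: field_simps)
  moreover have "cr_num a b c (cross_ratio a b c u) = v * ((c - b) * (b - a)) / (v - b)"
    unfolding cr_num_def eq using \<open>v \<noteq> b\<close> by (simp add: field_simps)
  ultimately show ?thesis
    using assms \<open>v \<noteq> b\<close> by (simp add: ratio_point_def Some)
qed

lemma cross_ratio_eq_0_iff:
  assumes "a \<noteq> b" "b \<noteq> c" "a \<noteq> c" "u \<noteq> Some b"
  shows "cross_ratio a b c u = 0 \<longleftrightarrow> u = Some a"
  using assms by (cases u) auto

lemma cross_ratio_eq_1_iff:
  assumes "a \<noteq> b" "b \<noteq> c" "a \<noteq> c" "u \<noteq> Some b"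
  shows "cross_ratio a b c u = 1 \<longleftrightarrow> u = Some c"
proof (cases u)
  case None
  then show ?thesis using assms by auto
next
  case (Some v)
  have "(v - a) * (c - b) - (v - b) * (c - a) = (v - c) * (a - b)"
    by (simp add: algebra_simps)
  then have "(v - a) * (c - b) = (v - b) * (c - a) \<longleftrightarrow> v = c"
    using assms by (metis eq_iff_diff_eq_0 mult_eq_0_iff)
  then show ?thesis using assms Some by (simp add: divide_eq_1_iff)
qed

lemma cross_ratio_swap: "cross_ratio b a c u = inverse (cross_ratio a b c u)"
  by (cases u) (simp_all add: field_simps)

text \<open>
  A pole of \<open>f\<close> is no singularity of the cross ratio: with \<open>g = 1 / f\<close>, which is analytic and zero there,
  the cross ratio equals \<open>(1 - a * g) * (c - b) / ((1 - b * g) * (c - a))\<close>.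
\<close>

lemma cross_ratio_sphere_val_holomorphic:
  assumes "open U" and f: "f nicely_meromorphic_on U"
    and hol: "a holomorphic_on U" "b holomorphic_on U" "c holomorphic_on U"
    and ac: "\<And>z. z \<in> U \<Longrightarrow> a z \<noteq> c z"
    and omit: "\<And>z. z \<in> U \<Longrightarrow> sphere_val f z \<noteq> Some (b z)"
  shows "(\<lambda>z. cross_ratio (a z) (b z) (c z) (sphere_val f z)) holomorphic_on U"
proof -
  let ?\<phi> = "\<lambda>z. cross_ratio (a z) (b z) (c z) (sphere_val f z)"
  have "?\<phi> analytic_on {z}" if z: "z \<in> U" for z
  proof -
    have an: "a analytic_on {z}" "b analytic_on {z}" "c analytic_on {z}"
      using hol z \<open>open U\<close> holomorphic_on_imp_analytic_at by blast+
    have mero: "f meromorphic_on {z}"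
      using f z by (auto simp: nicely_meromorphic_on_def intro: meromorphic_on_subset)
    have iso: "\<forall>\<^sub>F w in at z. f analytic_on {w}"
      using meromorphic_on_imp_analytic_cosparse[OF mero] eventually_cosparse_imp_eventually_at by blast
    then have nopole: "\<forall>\<^sub>F w in at z. \<not> is_pole f w"
      by eventually_elim (blast dest: analytic_at_imp_no_pole)
    show ?thesis
    proof (cases "is_pole f z")
      case False
      have fan: "f analytic_on {z}"
        using nicely_meromorphic_on_imp_analytic_at[OF f z False] .
      have ev: "\<forall>\<^sub>F w in nhds z. (f w - a w) * (c w - b w) / ((f w - b w) * (c w - a w)) = ?\<phi> w"
        using nopole unfolding eventually_at_filter
        by eventually_elim (use False in \<open>auto simp: sphere_val_def\<close>)
      have "f z \<noteq> b z" using omit[OF z] False by (simp add: sphere_val_def)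
      then have "(\<lambda>w. (f w - a w) * (c w - b w) / ((f w - b w) * (c w - a w))) analytic_on {z}"
        using an fan ac[OF z] by (intro analytic_intros) auto
      then show ?thesis
        using analytic_at_cong[OF ev refl] by simp
    next
      case True
      define g where "g = (\<lambda>w. inverse (f w))"
      have gn: "g nicely_meromorphic_on U"
        unfolding g_def by (rule nicely_meromorphic_on_inverse[OF f])
      \<comment> \<open>A nicely meromorphic function is \<open>0\<close> at its poles, and \<open>inverse 0 = 0\<close>.\<close>
      have gz: "g z = 0"
        using f z True unfolding nicely_meromorphic_on_def g_def
        by (metis inverse_zero is_pole_def not_tendsto_and_filterlim_at_infinity trivial_limit_at)
      have "(g \<longlongrightarrow> 0) (at z)"
        using True unfolding g_def is_pole_def by (rule filterlim_compose[OF tendsto_inverse_0])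
      then have "\<not> is_pole g z"
        unfolding is_pole_def using not_tendsto_and_filterlim_at_infinity trivial_limit_at by blast
      then have gan: "g analytic_on {z}"
        using nicely_meromorphic_on_imp_analytic_at[OF gn z] by blast
      have nz: "\<forall>\<^sub>F w in at z. f w \<noteq> 0"
        using True by (rule non_zero_neighbour_pole)
      have ev: "\<forall>\<^sub>F w in nhds z. (1 - a w * g w) * (c w - b w) / ((1 - b w * g w) * (c w - a w)) = ?\<phi> w"
        using nopole nz unfolding eventually_at_filter
      proof eventually_elim
        case (elim w)
        show ?case
        proof (cases "w = z")
          case True
          then show ?thesis using gz \<open>is_pole f z\<close> by (simp add: sphere_val_def)
        next
          case False
          then have w: "\<not> is_pole f w" "f w \<noteq> 0" using elim by auto
          then have "1 - a w * g w = (f w - a w) / f w" "1 - b w * g w = (f w - b w) / f w"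
            by (simp_all add: g_def field_simps)
          then show ?thesis using w by (simp add: sphere_val_def)
        qed
      qed
      have "(\<lambda>w. (1 - a w * g w) * (c w - b w) / ((1 - b w * g w) * (c w - a w))) analytic_on {z}"
        using an gan ac[OF z] gz by (intro analytic_intros) auto
      then show ?thesis
        using analytic_at_cong[OF ev refl] by simp
    qed
  qed
  then show ?thesis
    using analytic_on_analytic_at analytic_imp_holomorphic by blast
qed

section \<open>Normality of functions omitting three functions\<close>

lemma continuous_on_stereographic_ratio_point:
  assumes "continuous_on S p" "continuous_on S q"
    and nz: "\<And>x. x \<in> S \<Longrightarrow> p x \<noteq> 0 \<or> q x \<noteq> 0"
  shows "continuous_on S (\<lambda>x. stereographic (ratio_point (p x) (q x)))"
proof -
  have pos: "(cmod (p x))\<^sup>2 + (cmod (q x))\<^sup>2 \<noteq> 0" if "x \<in> S" for x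
    using nz[OF that] by (simp add: sum_power2_eq_zero_iff)
  have "continuous_on S (\<lambda>x. ((2 / ((cmod (p x))\<^sup>2 + (cmod (q x))\<^sup>2)) *\<^sub>R (p x * cnj (q x)),
            ((cmod (p x))\<^sup>2 - (cmod (q x))\<^sup>2) / ((cmod (p x))\<^sup>2 + (cmod (q x))\<^sup>2)))"
    using pos by (intro continuous_intros assms) auto
  then show ?thesis
    by (rule continuous_on_eq) (use nz in \<open>simp add: stereographic_ratio_point\<close>)
qed

text \<open>
  The map from \<open>(z, w)\<close> to the stereographic image of the point with cross ratio \<open>w\<close> is continuous on
  \<open>K \<times> \<complex>\<close>, hence uniformly continuous where \<open>w\<close> stays in a closed disc; from some index on, all values
  \<open>\<phi> n z\<close> lie in the disc whose radius exceeds a bound of the limit by one.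
\<close>

lemma uniform_limit_inverse_cross_ratio:
  fixes K :: "'a::metric_space set"
  assumes "compact K"
    and cont: "continuous_on K a" "continuous_on K b" "continuous_on K c"
    and ab: "\<And>z. z \<in> K \<Longrightarrow> a z \<noteq> b z" and bc: "\<And>z. z \<in> K \<Longrightarrow> b z \<noteq> c z"
    and g: "continuous_on K g" and lim: "uniform_limit K \<phi> g sequentially"
  shows "uniform_limit K
           (\<lambda>n z. stereographic (ratio_point (cr_num (a z) (b z) (c z) (\<phi> n z)) (cr_den (a z) (b z) (c z) (\<phi> n z))))
           (\<lambda>z. stereographic (ratio_point (cr_num (a z) (b z) (c z) (g z)) (cr_den (a z) (b z) (c z) (g z))))
           sequentially"
proof -
  have "bounded (g ` K)"
    using g \<open>compact K\<close> by (simp add: compact_continuous_image compact_imp_bounded)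
  then obtain B where B: "\<And>z. z \<in> K \<Longrightarrow> cmod (g z) \<le> B"
    by (auto simp: bounded_iff)
  define C where "C = K \<times> cball (0::complex) (B + 1)"
  have "compact C" unfolding C_def using \<open>compact K\<close> by (intro compact_Times) auto
  define \<Phi> where "\<Phi> = (\<lambda>x. stereographic (ratio_point
      (cr_num (a (fst x)) (b (fst x)) (c (fst x)) (snd x)) (cr_den (a (fst x)) (b (fst x)) (c (fst x)) (snd x))))"
  have fstc: "continuous_on C (\<lambda>x. a (fst x))" "continuous_on C (\<lambda>x. b (fst x))" "continuous_on C (\<lambda>x. c (fst x))"
    by (auto intro!: continuous_on_compose2[OF cont(1)] continuous_on_compose2[OF cont(2)]
        continuous_on_compose2[OF cont(3)] continuous_intros simp: C_def)
  have "continuous_on C \<Phi>"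
    unfolding \<Phi>_def
  proof (rule continuous_on_stereographic_ratio_point)
    fix x assume "x \<in> C"
    then have "fst x \<in> K" by (auto simp: C_def)
    then show "cr_num (a (fst x)) (b (fst x)) (c (fst x)) (snd x) \<noteq> 0 \<or>
        cr_den (a (fst x)) (b (fst x)) (c (fst x)) (snd x) \<noteq> 0"
      by (intro cr_num_or_den_nonzero ab bc)
  next
    show "continuous_on C (\<lambda>x. cr_num (a (fst x)) (b (fst x)) (c (fst x)) (snd x))"
      unfolding cr_num_def by (intro continuous_intros fstc)
    show "continuous_on C (\<lambda>x. cr_den (a (fst x)) (b (fst x)) (c (fst x)) (snd x))"
      unfolding cr_den_def by (intro continuous_intros fstc)
  qed
  then have uc: "uniformly_continuous_on C \<Phi>"
    using \<open>compact C\<close> by (rule compact_uniformly_continuous)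
  have "uniform_limit K (\<lambda>n z. (z, \<phi> n z)) (\<lambda>z. (z, g z)) sequentially"
    using lim by (auto simp: uniform_limit_iff dist_Pair_Pair)
  moreover have "\<forall>\<^sub>F n in sequentially. \<forall>z\<in>K. (z, \<phi> n z) \<in> C"
  proof -
    have "\<forall>\<^sub>F n in sequentially. \<forall>z\<in>K. dist (\<phi> n z) (g z) < 1"
      using lim by (auto simp: uniform_limit_iff)
    then show ?thesis
    proof eventually_elim
      case (elim n)
      have "cmod (\<phi> n z) \<le> B + 1" if "z \<in> K" for z
        using elim[rule_format, OF that] B[OF that] norm_triangle_sub[of "\<phi> n z" "g z"]
        by (simp add: dist_norm)
      then show ?case by (auto simp: C_def)
    qed
  qed
  ultimately have "uniform_limit K (\<lambda>n z. \<Phi> (z, \<phi> n z)) (\<lambda>z. \<Phi> (z, g z)) sequentially"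
    using uniform_limit_compose_uniformly_continuous_on[OF _ uc] \<open>compact C\<close> compact_imp_closed by blast
  then show ?thesis by (simp add: \<Phi>_def)
qed

text \<open>
  Zeros of \<open>q\<close> are poles of \<open>p / q\<close>, since they are isolated on a domain unless \<open>q\<close> vanishes
  identically, and \<open>p\<close> does not vanish there. At such a zero \<open>p / q\<close> has the default value
  \<open>0\<close> of a division by zero, as a nicely meromorphic function must have at a pole.
\<close>

lemma meromorphic_or_infinite_ratio_point:
  assumes U: "open U" "connected U" and hol: "p holomorphic_on U" "q holomorphic_on U"
    and nz: "\<And>z. z \<in> U \<Longrightarrow> p z \<noteq> 0 \<or> q z \<noteq> 0"
  obtains G where "(\<exists>h. h nicely_meromorphic_on U \<and> G = sphere_val h) \<or> G = (\<lambda>_. None)"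
    "\<And>z. z \<in> U \<Longrightarrow> G z = ratio_point (p z) (q z)"
proof (cases "\<forall>z\<in>U. q z = 0")
  case True
  show ?thesis
    by (rule that[of "\<lambda>_. None"]) (use True in \<open>auto simp: ratio_point_def\<close>)
next
  case False
  define h where "h = (\<lambda>z. p z / q z)"
  have an: "p analytic_on U" "q analytic_on U"
    using hol U by (simp_all add: analytic_on_open)
  have pole: "is_pole h z" if z: "z \<in> U" "q z = 0" for z
    unfolding h_def
  proof (rule is_pole_divide)
    show "isCont p z" "p z \<noteq> 0"
      using hol U z nz[OF z(1)] by (auto simp: continuous_on_eq_continuous_at dest: holomorphic_on_imp_continuous_on)
    have "q \<midarrow>z\<rightarrow> 0"
      using hol(2) U z by (metis continuous_on_eq_continuous_at holomorphic_on_imp_continuous_on isCont_def)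
    moreover have "\<forall>\<^sub>F w in at z. q w \<noteq> 0"
    proof -
      obtain z' where "z' \<in> U" "q z' \<noteq> 0" using False by blast
      from non_zero_neighbour_alt[OF hol(2) U z(1) this] show ?thesis
        by (rule eventually_mono) simp
    qed
    ultimately show "filterlim q (at 0) (at z)" by (simp add: filterlim_at)
  qed
  have cont: "isCont h z" if z: "z \<in> U" "q z \<noteq> 0" for z
    unfolding h_def using hol U z
    by (intro continuous_intros) (auto simp: continuous_on_eq_continuous_at dest: holomorphic_on_imp_continuous_on)
  have "h meromorphic_on U"
    unfolding h_def by (intro meromorphic_intros analytic_on_imp_meromorphic_on an)
  moreover have "is_pole h z \<and> h z = 0 \<or> h \<midarrow>z\<rightarrow> h z" if "z \<in> U" for z
    using pole[OF that] cont[OF that] by (cases "q z = 0") (auto simp: isCont_def h_def)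
  ultimately have "h nicely_meromorphic_on U"
    by (simp add: nicely_meromorphic_on_def)
  moreover have "sphere_val h z = ratio_point (p z) (q z)" if "z \<in> U" for z
  proof (cases "q z = 0")
    case True
    then show ?thesis using pole[OF that] by (simp add: sphere_val_def ratio_point_def)
  next
    case False
    then have "\<not> is_pole h z"
      using cont[OF that] unfolding isCont_def is_pole_def
      using not_tendsto_and_filterlim_at_infinity trivial_limit_at by blast
    then show ?thesis using False by (simp add: sphere_val_def ratio_point_def h_def)
  qed
  ultimately show ?thesis using that by blast
qed

text \<open>
  The bound at the single point \<open>w\<close> selects a subsequence whose cross ratios cannot tend to \<open>\<infinity>\<close>, so that
  Montel's theorem for locally bounded holomorphic functions suffices. The limit may still be the constant \<open>0\<close>
  or \<open>1\<close>, in which case the functions themselves tend to \<open>a\<close> or \<open>c\<close>.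
\<close>

lemma normal_if_cross_ratio_bounded_at_point:
  fixes f :: "nat \<Rightarrow> complex \<Rightarrow> complex"
  assumes U: "open U" "connected U" and "w \<in> U"
    and f: "\<And>n. f n nicely_meromorphic_on U"
    and hol: "a holomorphic_on U" "b holomorphic_on U" "c holomorphic_on U"
    and dist: "\<And>z. z \<in> U \<Longrightarrow> a z \<noteq> b z" "\<And>z. z \<in> U \<Longrightarrow> b z \<noteq> c z" "\<And>z. z \<in> U \<Longrightarrow> a z \<noteq> c z"
    and omit: "\<And>n z. z \<in> U \<Longrightarrow> sphere_val (f n) z \<notin> {Some (a z), Some (b z), Some (c z)}"
    and inf: "infinite {n. cmod (cross_ratio (a w) (b w) (c w) (sphere_val (f n) w)) \<le> 1}"
  obtains r :: "nat \<Rightarrow> nat" and G where "strict_mono r"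
    "(\<exists>h. h nicely_meromorphic_on U \<and> G = sphere_val h) \<or> G = (\<lambda>_. None)"
    "spherical_limit_on (\<lambda>n. f (r n)) G U"
proof -
  define \<phi> where "\<phi> n z = cross_ratio (a z) (b z) (c z) (sphere_val (f n) z)" for n z
  obtain s :: "nat \<Rightarrow> nat" where s: "strict_mono s" "\<And>n. cmod (\<phi> (s n) w) \<le> 1"
    using infinite_enumerate[OF inf] by (auto simp: \<phi>_def)
  have hol\<phi>: "\<phi> n holomorphic_on U" for n
    unfolding \<phi>_def
    using cross_ratio_sphere_val_holomorphic[OF U(1) f hol] dist omit by blast
  have \<phi>01: "\<phi> n z \<noteq> 0 \<and> \<phi> n z \<noteq> 1" if "z \<in> U" for n z
    unfolding \<phi>_def using omit[OF that, of n] dist that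
    by (simp add: cross_ratio_eq_0_iff cross_ratio_eq_1_iff)
  define Y where "Y = range (\<lambda>n. \<phi> (s n))"
  have holY: "h holomorphic_on U" if "h \<in> Y" for h
    using that hol\<phi> by (auto simp: Y_def)
  have "\<exists>B. \<forall>h\<in>Y. \<forall>z\<in>K. cmod (h z) \<le> B" if K: "compact K" "K \<subseteq> U" for K
  proof -
    have Y01: "h z \<noteq> 0 \<and> h z \<noteq> 1" if "h \<in> Y" "z \<in> U" for h z
      using that \<phi>01 by (auto simp: Y_def)
    have Y1: "cmod (h w) \<le> 1" if "h \<in> Y" for h
      using that s(2) by (auto simp: Y_def)
    \<comment> \<open>This is Schottky's theorem propagated along the connected set \<open>U\<close>.\<close>
    show ?thesis
    proof (rule GPicard3[where X = Y and Y = Y and S = U and w = w and K = K])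
      fix B assume "\<And>h z. h \<in> Y \<Longrightarrow> z \<in> K \<Longrightarrow> cmod (h z) \<le> B"
      then show ?thesis by blast
    qed (use U \<open>w \<in> U\<close> K holY Y01 Y1 in blast)+
  qed
  then obtain g t where g: "g holomorphic_on U" and t: "strict_mono (t :: nat \<Rightarrow> nat)"
    and lim: "\<And>K. compact K \<Longrightarrow> K \<subseteq> U \<Longrightarrow> uniform_limit K ((\<lambda>n. \<phi> (s n)) \<circ> t) g sequentially"
    using Montel[where S = U and \<H> = Y and \<F> = "\<lambda>n. \<phi> (s n)"] U(1) holY
    by (metis Y_def order_refl)
  define p where "p z = cr_num (a z) (b z) (c z) (g z)" for z
  define q where "q z = cr_den (a z) (b z) (c z) (g z)" for z
  have "p holomorphic_on U" "q holomorphic_on U"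
    unfolding p_def q_def cr_num_def cr_den_def by (intro holomorphic_intros hol g)+
  moreover have "p z \<noteq> 0 \<or> q z \<noteq> 0" if "z \<in> U" for z
    unfolding p_def q_def using dist that by (intro cr_num_or_den_nonzero) auto
  ultimately obtain G where G: "(\<exists>h. h nicely_meromorphic_on U \<and> G = sphere_val h) \<or> G = (\<lambda>_. None)"
    and GU: "\<And>z. z \<in> U \<Longrightarrow> G z = ratio_point (p z) (q z)"
    using meromorphic_or_infinite_ratio_point[OF U] by metis
  have "spherical_limit_on (\<lambda>n. f ((s \<circ> t) n)) G U"
  proof (rule spherical_limit_onI)
    fix K assume K: "compact K" "K \<subseteq> U"
    have fz: "sphere_val (f n) z =
        ratio_point (cr_num (a z) (b z) (c z) (\<phi> n z)) (cr_den (a z) (b z) (c z) (\<phi> n z))"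
      if "z \<in> U" for n z
      unfolding \<phi>_def using ratio_point_cross_ratio[of "a z" "b z" "c z" "sphere_val (f n) z"]
        dist[OF that] omit[OF that, of n] by simp
    have cont: "continuous_on K h" if "h holomorphic_on U" for h
      using that K holomorphic_on_imp_continuous_on continuous_on_subset by blast
    have "uniform_limit K
           (\<lambda>n z. stereographic (ratio_point (cr_num (a z) (b z) (c z) (\<phi> (s (t n)) z))
                                             (cr_den (a z) (b z) (c z) (\<phi> (s (t n)) z))))
           (\<lambda>z. stereographic (ratio_point (p z) (q z))) sequentially"
      unfolding p_def q_def
      using dist K lim[OF K]
      by (intro uniform_limit_inverse_cross_ratio cont hol g) (auto simp: o_def)
    then show "uniform_limit K (\<lambda>n z. stereographic (sphere_val (f ((s \<circ> t) n)) z))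
        (\<lambda>z. stereographic (G z)) sequentially"
      by (rule uniform_limit_cong'[THEN iffD1, rotated -1]) (use fz GU K in auto)
  qed
  moreover have "strict_mono (s \<circ> t)" using s(1) t by (rule strict_mono_o)
  ultimately show ?thesis using that G by blast
qed

text \<open>
  Montel's normality criterion with moving targets. Exchanging \<open>a\<close> and \<open>b\<close> inverts the cross ratio, so
  that one of the two orders gives a bound at the chosen point for infinitely many indices.
\<close>

lemma normal_if_omits_three_functions:
  fixes f :: "nat \<Rightarrow> complex \<Rightarrow> complex"
  assumes U: "open U" "connected U" and "U \<noteq> {}"
    and f: "\<And>n. f n nicely_meromorphic_on U"
    and hol: "a holomorphic_on U" "b holomorphic_on U" "c holomorphic_on U"
    and dist: "\<And>z. z \<in> U \<Longrightarrow> a z \<noteq> b z" "\<And>z. z \<in> U \<Longrightarrow> b z \<noteq> c z" "\<And>z. z \<in> U \<Longrightarrow> a z \<noteq> c z"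
    and omit: "\<And>n z. z \<in> U \<Longrightarrow> sphere_val (f n) z \<notin> {Some (a z), Some (b z), Some (c z)}"
  obtains r :: "nat \<Rightarrow> nat" and G where "strict_mono r"
    "(\<exists>h. h nicely_meromorphic_on U \<and> G = sphere_val h) \<or> G = (\<lambda>_. None)"
    "spherical_limit_on (\<lambda>n. f (r n)) G U"
proof -
  obtain w where w: "w \<in> U" using \<open>U \<noteq> {}\<close> by blast
  let ?A = "{n. cmod (cross_ratio (a w) (b w) (c w) (sphere_val (f n) w)) \<le> 1}"
  let ?B = "{n. cmod (cross_ratio (b w) (a w) (c w) (sphere_val (f n) w)) \<le> 1}"
  have "n \<in> ?A \<union> ?B" for n
    using cross_ratio_swap[of "b w" "a w" "c w" "sphere_val (f n) w"]
    by (auto simp: norm_inverse inverse_le_1_iff)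
  then have "?A \<union> ?B = UNIV" by blast
  then have "infinite (?A \<union> ?B)" by (metis infinite_UNIV_nat)
  then consider "infinite ?A" | "infinite ?B" by blast
  then show ?thesis
  proof cases
    case 1
    show ?thesis
      by (rule normal_if_cross_ratio_bounded_at_point[OF U w f hol dist omit 1 that])
  next
    case 2
    have dist': "\<And>z. z \<in> U \<Longrightarrow> b z \<noteq> a z" using dist by metis
    have omit': "\<And>n z. z \<in> U \<Longrightarrow> sphere_val (f n) z \<notin> {Some (b z), Some (a z), Some (c z)}"
      using omit by blast
    show ?thesis
      by (rule normal_if_cross_ratio_bounded_at_point[OF U w f hol(2,1,3) dist' dist(3,2) omit' 2 that])
  qed
qed

section \<open>Quasi-normality\<close>

text \<open>
  The identity theorem for \<open>f - a\<close>. It gives equality only away from a sparse set; near a remaining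
  point \<open>f\<close> then tends to the finite value of \<open>a\<close>, so there is no pole and the values agree as well.
\<close>

lemma sparse_coincidence_set:
  assumes D: "open D" "connected D" and f: "f nicely_meromorphic_on D" and a: "a holomorphic_on D"
    and ne: "\<not> (\<forall>z\<in>D. sphere_val f z = Some (a z))"
  shows "{z\<in>D. sphere_val f z = Some (a z)} sparse_in D"
proof -
  have "f meromorphic_on D" "a meromorphic_on D"
    using f a D by (simp_all add: nicely_meromorphic_on_def analytic_on_imp_meromorphic_on analytic_on_open)
  then have "(\<lambda>z. f z - a z) meromorphic_on D"
    by (rule meromorphic_on_diff)
  then consider "\<forall>\<^sub>\<approx>z\<in>D. f z - a z = 0" | "\<forall>\<^sub>\<approx>z\<in>D. f z - a z \<noteq> 0"
    using meromorphic_imp_constant_or_avoid[OF _ D] by blast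
  then show ?thesis
  proof cases
    case 1
    have "sphere_val f z = Some (a z)" if z: "z \<in> D" for z
    proof -
      have "\<forall>\<^sub>F w in at z. a w = f w"
        using eventually_cosparse_imp_eventually_at[OF 1 z] by eventually_elim simp
      moreover have "a \<midarrow>z\<rightarrow> a z"
        using a D z by (metis continuous_on_eq_continuous_at holomorphic_on_imp_continuous_on isCont_def)
      ultimately have lim: "f \<midarrow>z\<rightarrow> a z"
        using tendsto_cong by blast
      then have "\<not> is_pole f z"
        unfolding is_pole_def using not_tendsto_and_filterlim_at_infinity trivial_limit_at by blast
      then have "f \<midarrow>z\<rightarrow> f z" using f z by (auto simp: nicely_meromorphic_on_def)
      then have "f z = a z" using lim by (rule LIM_unique)
      then show ?thesis using \<open>\<not> is_pole f z\<close> by (simp add: sphere_val_def)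
    qed
    then show ?thesis using ne by blast
  next
    case 2
    then have "{z. \<not> f z - a z \<noteq> 0} sparse_in D" by (simp add: eventually_cosparse)
    then show ?thesis
      by (rule sparse_in_subset2) (auto simp: sphere_val_def split: if_splits)
  qed
qed

lemma sphere_val_holomorphic:
  assumes "open D" "a holomorphic_on D" "z \<in> D"
  shows "sphere_val a z = Some (a z)"
proof -
  have "\<not> is_pole a z"
    using assms not_is_pole_holomorphic by blast
  then show ?thesis by (simp add: sphere_val_def)
qed

lemma sparse_equality_set:
  assumes D: "open D" "connected D" and hol: "a holomorphic_on D" "b holomorphic_on D"
    and ne: "\<not> (\<forall>z\<in>D. a z = b z)"
  shows "{z\<in>D. a z = b z} sparse_in D"
proof -
  have "a nicely_meromorphic_on D"
    using hol D by (simp add: analytic_on_imp_nicely_meromorphic_on analytic_on_open)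
  moreover have sv: "sphere_val a z = Some (b z) \<longleftrightarrow> a z = b z" if "z \<in> D" for z
    using sphere_val_holomorphic[OF D(1) hol(1) that] by simp
  ultimately have "{z\<in>D. sphere_val a z = Some (b z)} sparse_in D"
    using ne by (intro sparse_coincidence_set D hol) auto
  moreover have "{z\<in>D. sphere_val a z = Some (b z)} = {z\<in>D. a z = b z}"
    using sv by blast
  ultimately show ?thesis by simp
qed

lemma spherical_dist_self: "spherical_dist p p = 0"
  by (simp add: spherical_dist_def norm_eq_1[THEN iffD1, OF norm_stereographic])

theorem theorem2p10:
  fixes D :: "complex set"
    and \<F> :: "(complex \<Rightarrow> complex) set"
    and a1 a2 a3 :: "complex \<Rightarrow> complex"
  assumes "open D" and "connected D" and "D \<noteq> {}"
    and "\<And>f. f \<in> \<F> \<Longrightarrow> f nicely_meromorphic_on D"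
    and "a1 holomorphic_on D" and "a2 holomorphic_on D" and "a3 holomorphic_on D"
    and "\<not> (\<forall>z\<in>D. a1 z = a2 z)"
    and "\<not> (\<forall>z\<in>D. a1 z = a3 z)"
    and "\<not> (\<forall>z\<in>D. a2 z = a3 z)"
    and "\<And>f g. f \<in> \<F> \<Longrightarrow> g \<in> \<F> \<Longrightarrow>
           shares_on f g a1 D \<and> shares_on f g a2 D \<and> shares_on f g a3 D"
  shows "quasi_normal_on \<F> D"
  unfolding quasi_normal_on_def
proof (intro allI impI)
  fix f :: "nat \<Rightarrow> complex \<Rightarrow> complex"
  assume "\<forall>n. f n \<in> \<F>"
  then have fF: "f n \<in> \<F>" for n by blast
  have mero: "f n nicely_meromorphic_on D" for n using assms(4) fF by blast
  have shares: "sphere_val (f n) z = Some (a z) \<longleftrightarrow> sphere_val (f 0) z = Some (a z)"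
    if "a \<in> {a1, a2, a3}" "z \<in> D" for a n z
    using assms(11)[OF fF[of n] fF[of 0]] that by (auto simp: shares_on_def)
  show "\<exists>(r :: nat \<Rightarrow> nat) E G.
           strict_mono r \<and> E \<subseteq> D \<and> (\<forall>z\<in>D. \<not> z islimpt E) \<and>
           ((\<exists>h. h nicely_meromorphic_on (D - E) \<and> G = sphere_val h) \<or> G = (\<lambda>_. None)) \<and>
           spherical_limit_on (\<lambda>n. f (r n)) G (D - E)"
  proof (cases "\<exists>a\<in>{a1, a2, a3}. \<forall>z\<in>D. sphere_val (f 0) z = Some (a z)")
    case True
    then obtain a where a: "a \<in> {a1, a2, a3}" and "\<forall>z\<in>D. sphere_val (f 0) z = Some (a z)"
      by blast
    then have same: "sphere_val (f n) z = sphere_val (f 0) z" if "z \<in> D" for n z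
      using shares[OF a that, of n] that by simp
    have "spherical_dist (sphere_val (f n) z) (sphere_val (f 0) z) = 0" if "z \<in> D" for n z
      unfolding same[OF that, of n] by (rule spherical_dist_self)
    then have "spherical_limit_on f (sphere_val (f 0)) D"
      unfolding spherical_limit_on_def subset_iff by simp
    then have "strict_mono (\<lambda>n::nat. n) \<and> {} \<subseteq> D \<and> (\<forall>z\<in>D. \<not> z islimpt {}) \<and>
           ((\<exists>h. h nicely_meromorphic_on (D - {}) \<and> sphere_val (f 0) = sphere_val h) \<or>
             sphere_val (f 0) = (\<lambda>_. None)) \<and>
           spherical_limit_on (\<lambda>n. f n) (sphere_val (f 0)) (D - {})"
      using mero[of 0] by (auto simp: strict_mono_def)
    then show ?thesis by blast
  next
    case False
    define E where "E = (\<Union>a\<in>{a1, a2, a3}. {z\<in>D. sphere_val (f 0) z = Some (a z)}) \<union>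
       ({z\<in>D. a1 z = a2 z} \<union> {z\<in>D. a1 z = a3 z} \<union> {z\<in>D. a2 z = a3 z})"
    have "E sparse_in D"
      unfolding E_def
    proof (intro sparse_in_union' sparse_in_UN_finite)
      fix a assume "a \<in> {a1, a2, a3}"
      then have "a holomorphic_on D" "\<not> (\<forall>z\<in>D. sphere_val (f 0) z = Some (a z))"
        using False assms(5-7) by blast+
      then show "{z\<in>D. sphere_val (f 0) z = Some (a z)} sparse_in D"
        by (intro sparse_coincidence_set assms(1,2) mero)
    qed (rule sparse_equality_set assms(1,2,5-10) | simp)+
    then have lim: "\<forall>z\<in>D. \<not> z islimpt E"
      using sparse_in_open[OF \<open>open D\<close>] by blast
    have U: "open (D - E)" "connected (D - E)"
      using open_diff_sparse_pts[OF \<open>open D\<close> \<open>E sparse_in D\<close>]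
        sparse_imp_connected[OF _ \<open>connected D\<close> \<open>open D\<close> \<open>E sparse_in D\<close>] by auto
    have ne: "D - E \<noteq> {}"
    proof
      assume "D - E = {}"
      then have "D \<subseteq> E" by blast
      obtain z where "z \<in> D" using \<open>D \<noteq> {}\<close> by blast
      then have "z islimpt D"
        using \<open>open D\<close> by (simp add: interior_limit_point interior_open)
      then show False using lim \<open>z \<in> D\<close> \<open>D \<subseteq> E\<close> islimpt_subset by blast
    qed
    have meroE: "f n nicely_meromorphic_on D - E" for n
      using mero nicely_meromorphic_on_subset by blast
    have holE: "a1 holomorphic_on D - E" "a2 holomorphic_on D - E" "a3 holomorphic_on D - E"
      using assms(5-7) holomorphic_on_subset by blast+
    have distinct: "a1 z \<noteq> a2 z" "a2 z \<noteq> a3 z" "a1 z \<noteq> a3 z" if "z \<in> D - E" for z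
      using that by (auto simp: E_def)
    have omit: "sphere_val (f n) z \<notin> {Some (a1 z), Some (a2 z), Some (a3 z)}" if "z \<in> D - E" for n z
      using that shares[of _ z n] by (auto simp: E_def)
    obtain r G where "strict_mono (r :: nat \<Rightarrow> nat)"
      "(\<exists>h. h nicely_meromorphic_on (D - E) \<and> G = sphere_val h) \<or> G = (\<lambda>_. None)"
      "spherical_limit_on (\<lambda>n. f (r n)) G (D - E)"
      by (rule normal_if_omits_three_functions[OF U ne meroE holE distinct omit])
    moreover have "E \<subseteq> D" by (auto simp: E_def)
    ultimately show ?thesis using lim by blast
  qed
qed

end
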